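(* The optimization problem (A): maximize $$\sum_{n=1}^{N}\sum_{k=1}^{K}\pi_{kn}\bigl(U(\gamma_k)-t_k\bigr)$$ over $(\gamma_1,\dots,\gamma_K)$ with $0\le\gamma_1\le\gamma_2\le\cdots\le\gamma_K$, where the transfers are determined by $$t_1=\frac{c\gamma_1}{\delta_1},\qquad t_k=\frac{c\gamma_1}{\delta_1}+\sum_{i=2}^{k}\frac{c(\gamma_i-\gamma_{i-1})}{\delta_i}\quad(2\le k\le K),$$ can be rewritten as the problem (B): maximize $$\sum_{n=1}^{N}\sum_{k=1}^{K}\pi_{kn}\,g_{n,k}(\gamma_k)\quad\text{subject to}\quad 0\le\gamma_1\le\gamma_2\le\cdots\le\gamma_K,$$ where, for $n\in\{1,\dots,N\}$, $$g_{n,k}(\gamma_k)=\begin{cases}U(\gamma_k)-\dfrac{c\gamma_k}{\delta_k}-c\gamma_k\left(\dfrac1{\delta_k}-\dfrac1{\delta_{k+1}}\right)\left(\dfrac{1-\sum_{i=1}^{k}\pi_{in}}{\pi_{kn}}\right), & k<K,\\[2ex] U(\gamma_K)-\dfrac{c\gamma_K}{\delta_K}, & k=K.\end{cases}$$ That is, problems (A) and (B) have the same feasible set of vectors $(\gamma_1,\dots,\gamma_K)$, and their objective functions agree at every feasible vector.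
   Context: $N\ge 1$ (number of subcarriers) and $K\ge 1$ (number of relay types) are integers. The relay types are real numbers $0<\delta_1<\delta_2<\cdots<\delta_K$, and $c>0$ is a constant (cost per unit power). For each subcarrier $n\in\{1,\dots,N\}$, $\pi_{kn}>0$ is the probability of type $\delta_k$ on subcarrier $n$, with $\sum_{k=1}^K\pi_{kn}=1$. $U:[0,\infty)\to\mathbb{R}$ is a concave function (the source's utility of SNR; the model example is $U(\gamma)=\tfrac12\log_2(1+\gamma)$). Here $\gamma_k$ is the SNR and $t_k$ the transfer in the contract intended for type $\delta_k$. *)

theory Defs
  imports "HOL-Analysis.Analysis"
begin

(* Vectors (x_1, ..., x_K) are functions on nat that are extensional on {1..K}, so that each
   vector has exactly one representative; p k n is the probability of type k on subcarrier n. *)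

record 'a max_problem =
  feasible :: "'a set"
  objective :: "'a \<Rightarrow> real"

definition monotone_snrs :: "nat \<Rightarrow> (nat \<Rightarrow> real) set" where
  "monotone_snrs K =
     {\<gamma> \<in> extensional {1..K}. 0 \<le> \<gamma> 1 \<and> (\<forall>k\<in>{1..<K}. \<gamma> k \<le> \<gamma> (Suc k))}"

(* For k = 1 the sum is empty, which covers the separate equation for t_1. *)
definition transfer :: "real \<Rightarrow> (nat \<Rightarrow> real) \<Rightarrow> (nat \<Rightarrow> real) \<Rightarrow> nat \<Rightarrow> real" where
  "transfer c \<delta> \<gamma> k = c * \<gamma> 1 / \<delta> 1 + (\<Sum>i=2..k. c * (\<gamma> i - \<gamma> (i - 1)) / \<delta> i)"

definition problem_A ::
  "nat \<Rightarrow> nat \<Rightarrow> real \<Rightarrow> (nat \<Rightarrow> real) \<Rightarrow> (nat \<Rightarrow> nat \<Rightarrow> real) \<Rightarrow> (real \<Rightarrow> real)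
    \<Rightarrow> (nat \<Rightarrow> real) max_problem" where
  "problem_A N K c \<delta> p U =
     \<lparr> feasible = monotone_snrs K,
       objective = (\<lambda>\<gamma>. \<Sum>n=1..N. \<Sum>k=1..K. p k n * (U (\<gamma> k) - transfer c \<delta> \<gamma> k)) \<rparr>"

definition g ::
  "nat \<Rightarrow> real \<Rightarrow> (nat \<Rightarrow> real) \<Rightarrow> (nat \<Rightarrow> nat \<Rightarrow> real) \<Rightarrow> (real \<Rightarrow> real)
    \<Rightarrow> nat \<Rightarrow> nat \<Rightarrow> real \<Rightarrow> real" where
  "g K c \<delta> p U n k x =
     (if k < K
      then U x - c * x / \<delta> k
             - c * x * (1 / \<delta> k - 1 / \<delta> (Suc k)) * ((1 - (\<Sum>i=1..k. p i n)) / p k n)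
      else U x - c * x / \<delta> k)"

definition problem_B ::
  "nat \<Rightarrow> nat \<Rightarrow> real \<Rightarrow> (nat \<Rightarrow> real) \<Rightarrow> (nat \<Rightarrow> nat \<Rightarrow> real) \<Rightarrow> (real \<Rightarrow> real)
    \<Rightarrow> (nat \<Rightarrow> real) max_problem" where
  "problem_B N K c \<delta> p U =
     \<lparr> feasible = monotone_snrs K,
       objective = (\<lambda>\<gamma>. \<Sum>n=1..N. \<Sum>k=1..K. p k n * g K c \<delta> p U n k (\<gamma> k)) \<rparr>"

end

theory Submission
  imports Defs
begin

(* Summation by parts turns the transfer t_k into c gamma_k / delta_k plus partial sums of
   d_i = c gamma_i (1 / delta_i - 1 / delta_(i+1)) over i < k. Averaging over the types and
   exchanging the order of summation, d_i receives the weight of all types above i, which is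
   1 minus the sum of the first i probabilities. *)

lemma transfer_eq:
  assumes "1 \<le> k"
  shows "transfer c \<delta> \<gamma> k =
         c * \<gamma> k / \<delta> k + (\<Sum>i=1..<k. c * \<gamma> i * (1 / \<delta> i - 1 / \<delta> (Suc i)))"
  using assms
proof (induction k rule: dec_induct)
  case base
  show ?case by (simp add: transfer_def)
next
  case (step m)
  have "transfer c \<delta> \<gamma> (Suc m) = transfer c \<delta> \<gamma> m + c * (\<gamma> (Suc m) - \<gamma> m) / \<delta> (Suc m)"
    using step.hyps by (simp add: transfer_def)
  with step show ?case
    by (simp add: right_diff_distrib diff_divide_distrib)
qed

text \<open>Both sides sum \<open>p k * d i\<close> over the pairs i < k, grouped by k on the left
  and by i on the right. The total of \<open>p\<close> stays symbolic because the induction passes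
  through shorter ranges, where it is not 1.\<close>

lemma sum_mult_partial_sum:
  fixes p d :: "nat \<Rightarrow> 'a::comm_ring"
  shows "(\<Sum>k=1..K. p k * (\<Sum>i=1..<k. d i)) =
         (\<Sum>i=1..<K. d i * ((\<Sum>j=1..K. p j) - (\<Sum>j=1..i. p j)))"
proof (induction K)
  case 0
  show ?case by simp
next
  case (Suc K)
  \<comment> \<open>Every tail gains \<open>p (Suc K)\<close>; collected over i, these gains form
    the new summand on the left-hand side.\<close>
  have "(\<Sum>i=1..<Suc K. d i * ((\<Sum>j=1..Suc K. p j) - (\<Sum>j=1..i. p j))) =
        (\<Sum>i=1..<Suc K. d i * ((\<Sum>j=1..K. p j) - (\<Sum>j=1..i. p j)) + p (Suc K) * d i)"
    by (intro sum.cong) (simp_all add: algebra_simps)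
  also have "\<dots> = (\<Sum>i=1..<Suc K. d i * ((\<Sum>j=1..K. p j) - (\<Sum>j=1..i. p j)))
      + p (Suc K) * (\<Sum>i=1..<Suc K. d i)"
    by (simp only: sum.distrib sum_distrib_left)
  \<comment> \<open>The term i = K has an empty tail and vanishes; for K = 0 both ranges are
    empty.\<close>
  also have "(\<Sum>i=1..<Suc K. d i * ((\<Sum>j=1..K. p j) - (\<Sum>j=1..i. p j))) =
      (\<Sum>i=1..<K. d i * ((\<Sum>j=1..K. p j) - (\<Sum>j=1..i. p j)))"
    by (cases K) simp_all
  finally show ?case
    using Suc by simp
qed

lemma expected_utility_eq:
  assumes pos: "\<And>k. k \<in> {1..K} \<Longrightarrow> p k n > 0"
    and total: "(\<Sum>k=1..K. p k n) = 1"
  shows "(\<Sum>k=1..K. p k n * (U (\<gamma> k) - transfer c \<delta> \<gamma> k)) =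
         (\<Sum>k=1..K. p k n * g K c \<delta> p U n k (\<gamma> k))"
proof -
  define d where "d i = c * \<gamma> i * (1 / \<delta> i - 1 / \<delta> (Suc i))" for i
  \<comment> \<open>Padding with 0 at K lets the sum run over all types, mirrors the case split in
    \<open>g\<close>, and keeps \<open>d K\<close>, which involves \<delta> beyond the last type,
    out of the sum.\<close>
  define h where "h k = (if k < K then d k * (1 - (\<Sum>j=1..k. p j n)) else 0)" for k
  have "(\<Sum>k=1..K. p k n * (\<Sum>i=1..<k. d i)) = (\<Sum>k=1..<K. d k * (1 - (\<Sum>j=1..k. p j n)))"
    using sum_mult_partial_sum[of "\<lambda>k. p k n" d K] total by simp
  also have "\<dots> = (\<Sum>k=1..K. h k)"
    by (intro sum.mono_neutral_cong_left) (auto simp: h_def)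
  finally have weights: "(\<Sum>k=1..K. p k n * (\<Sum>i=1..<k. d i)) = (\<Sum>k=1..K. h k)" .
  have "(\<Sum>k=1..K. p k n * (U (\<gamma> k) - transfer c \<delta> \<gamma> k)) =
        (\<Sum>k=1..K. p k n * (U (\<gamma> k) - c * \<gamma> k / \<delta> k) - p k n * (\<Sum>i=1..<k. d i))"
    by (intro sum.cong) (simp_all add: transfer_eq d_def right_diff_distrib distrib_left)
  \<comment> \<open>The subtracted terms need not agree for each k, only in total, so the sum is
    split before \<open>weights\<close> applies.\<close>
  also have "\<dots> = (\<Sum>k=1..K. p k n * (U (\<gamma> k) - c * \<gamma> k / \<delta> k) - h k)"
    by (simp only: sum_subtractf weights)
  also have "\<dots> = (\<Sum>k=1..K. p k n * g K c \<delta> p U n k (\<gamma> k))"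
  proof (intro sum.cong refl)
    fix k assume "k \<in> {1..K}"
    \<comment> \<open>This cancels the division by \<open>p k n\<close> inside
      \<open>g\<close>.\<close>
    then have "p k n \<noteq> 0" using pos by fastforce
    then show "p k n * (U (\<gamma> k) - c * \<gamma> k / \<delta> k) - h k = p k n * g K c \<delta> p U n k (\<gamma> k)"
      by (simp add: g_def h_def flip: d_def) (simp add: field_simps)
  qed
  finally show ?thesis .
qed

theorem proposition2:
  fixes N K :: nat
    and c :: real
    and \<delta> :: "nat \<Rightarrow> real"
    and p :: "nat \<Rightarrow> nat \<Rightarrow> real"
    and U :: "real \<Rightarrow> real"
  assumes "N \<ge> 1" and "K \<ge> 1"
    and "c > 0"
    and "0 < \<delta> 1" and "strict_mono_on {1..K} \<delta>"
    and "\<And>k n. k \<in> {1..K} \<Longrightarrow> n \<in> {1..N} \<Longrightarrow> p k n > 0"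
    and "\<And>n. n \<in> {1..N} \<Longrightarrow> (\<Sum>k=1..K. p k n) = 1"
    and "concave_on {0..} U"
  shows "feasible (problem_A N K c \<delta> p U) = feasible (problem_B N K c \<delta> p U) \<and>
         (\<forall>\<gamma> \<in> feasible (problem_A N K c \<delta> p U).
            objective (problem_A N K c \<delta> p U) \<gamma> = objective (problem_B N K c \<delta> p U) \<gamma>)"
proof -
  have "(\<Sum>n=1..N. \<Sum>k=1..K. p k n * (U (\<gamma> k) - transfer c \<delta> \<gamma> k)) =
        (\<Sum>n=1..N. \<Sum>k=1..K. p k n * g K c \<delta> p U n k (\<gamma> k))" for \<gamma>
    using assms(6,7) by (intro sum.cong expected_utility_eq) auto
  then show ?thesis
    by (simp add: problem_A_def problem_B_def)
qed

end
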